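(* Let $\Delta=\{(\hat\delta_0u_i)_{i\in J}:\ u\in[0,1]^J,\ \sum_{i\in J}u_i\le1\}$ be a 1-disruption uncertainty set with uniform deviation $\hat\delta_0>0$, let the precedence graph $G(p)$ be critical, and assume $M=L_{st}+\hat\delta_0M'$ with $M'$ an integer. Then formulation (Dom) yields a polyhedral characterization of the Anchor-Robust Project Scheduling Problem, i.e. $$\mathrm{Proj}_h(\mathcal{P}_{Dom})=\mathcal{Q},$$ where $\mathcal{Q}$ is the convex hull of the incidence vectors of anchored sets.
   Context: Let $J$ be a finite set of jobs and $\bar J=J\cup\{s,t\}$ with dummy jobs $s,t$ (start and end of the project). Let $G=(\bar J,\mathcal{A})$ be a directed acyclic graph with source $s$ and sink $t$; there is an arc $(s,i)$ (resp. $(i,t)$) for every $i\in J$ without predecessor (resp. successor) in $J$. For $q\in\mathbb{R}_+^J$ (with the convention $q_s=0$), $G(q)$ denotes $G$ with length $q_i$ on every arc $(i,j)\in\mathcal{A}$. A schedule of $G(q)$ is a vector $x\in\mathbb{R}_+^{\bar J}$ with $x_s=0$ and $x_j-x_i\ge q_i$ for every arc $(i,j)\in\mathcal{A}$; its makespan is $x_t$. Write $i\prec j$ if $i\ne j$ and there is a directed path from $i$ to $j$ in $G$, and for $i\prec j$ let $L_{G(q)}(i,j)$ be the length of a longest $i$–$j$ path in $G(q)$. Fix nominal processing times $p\in\mathbb{R}_+^J$ and a deadline $M\ge0$. For $i\prec j$ let $L_{ij}=L_{G(p)}(i,j)$ and $L^\Delta_{ij}=\max_{\delta\in\Delta}L_{G(p+\delta)}(i,j)$.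 The precedence graph $G(p)$ is critical if all $s$–$t$ paths in $G(p)$ have the same length $L_{st}$. Given a schedule $x$ of $G(p)$, a subset $H\subseteq J$ is $x$-anchored if for every $\delta\in\Delta$ there exists a schedule $x^\delta$ of $G(p+\delta)$ such that $x^\delta_i=x_i$ for every $i\in H$. A subset $H\subseteq J$ is anchored if there exists a schedule $x$ of $G(p)$ with $x_t\le M$ such that $H$ is $x$-anchored. The Anchor-Robust Project Scheduling Problem is to find an anchored set of maximum total weight for given nonnegative job weights. $\mathcal{P}_{Dom}$ (the continuous relaxation of formulation (Dom)) is the set of $(z,h)\in\mathbb{R}^{\bar J}\times[0,1]^J$ such that $z_j-z_i\ge p_i$ for all $(i,j)\in\mathcal{A}$; $z_t\le M$; $z_j-z_i\ge L_{ij}+(L^\Delta_{ij}-L_{ij})h_j$ for all $i,j\in\bar J$ with $i\prec j$ (with the convention $h_t=0$); $z_j\ge0$ for all $j\in\bar J$. $\mathrm{Proj}_h$ denotes the projection onto the $h$ variables. *)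

theory Defs
  imports "HOL-Analysis.Analysis"
begin

text \<open>The type \<open>'j\<close> is the set \<open>J\<close> of jobs, so \<open>'j node\<close> is \<open>J\<close> together with the two
  dummy jobs \<open>s\<close> (\<open>Source\<close>) and \<open>t\<close> (\<open>Sink\<close>). Vectors indexed by \<open>J\<close> live in \<open>real ^ 'j\<close>.\<close>

datatype 'j node = Source | Sink | Job 'j

text \<open>Conventions \<open>q\<^sub>s = 0\<close> and \<open>h\<^sub>t = 0\<close>. The values \<open>q\<^sub>t\<close> and \<open>h\<^sub>s\<close> are never used, because
  no arc leaves \<open>t\<close> or enters \<open>s\<close>.\<close>

primrec ext :: "real ^ 'j \<Rightarrow> 'j node \<Rightarrow> real" where
  "ext q Source = 0"
| "ext q Sink = 0"
| "ext q (Job i) = q $ i"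

definition project_graph :: "'j node rel \<Rightarrow> bool" where
  "project_graph A \<longleftrightarrow>
     acyclic A \<and>
     (\<forall>v. (v, Source) \<notin> A) \<and>
     (\<forall>v. (Sink, v) \<notin> A) \<and>
     (\<forall>i. (\<nexists>k. (Job k, Job i) \<in> A) \<longrightarrow> (Source, Job i) \<in> A) \<and>
     (\<forall>i. (\<nexists>k. (Job i, Job k) \<in> A) \<longrightarrow> (Job i, Sink) \<in> A)"

definition schedule :: "'j node rel \<Rightarrow> real ^ 'j \<Rightarrow> ('j node \<Rightarrow> real) \<Rightarrow> bool" where
  "schedule A q x \<longleftrightarrow>
     (\<forall>v. 0 \<le> x v) \<and> x Source = 0 \<and> (\<forall>(i, j) \<in> A. x j - x i \<ge> ext q i)"

definition prec :: "'j node rel \<Rightarrow> 'j node \<Rightarrow> 'j node \<Rightarrow> bool" where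
  "prec A i j \<longleftrightarrow> i \<noteq> j \<and> (i, j) \<in> A\<^sup>*"

text \<open>A path is given by its list of vertices; vertices are automatically distinct when the
  graph is acyclic.\<close>

definition paths :: "'j node rel \<Rightarrow> 'j node \<Rightarrow> 'j node \<Rightarrow> 'j node list set" where
  "paths A i j =
     {vs. vs \<noteq> [] \<and> hd vs = i \<and> last vs = j \<and> successively (\<lambda>u v. (u, v) \<in> A) vs}"

text \<open>Every arc leaving \<open>i\<close> has length \<open>q\<^sub>i\<close>, so all vertices but the last contribute.\<close>

definition path_length :: "real ^ 'j \<Rightarrow> 'j node list \<Rightarrow> real" where
  "path_length q vs = (\<Sum>v\<leftarrow>butlast vs. ext q v)"

text \<open>In an acyclic graph on \<open>'j node\<close> with \<open>'j\<close> finite there are only finitely many paths,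
  so this \<open>Max\<close> is meaningful whenever \<open>j\<close> is reachable from \<open>i\<close>.\<close>

definition longest :: "'j node rel \<Rightarrow> real ^ 'j \<Rightarrow> 'j node \<Rightarrow> 'j node \<Rightarrow> real" where
  "longest A q i j = Max (path_length q ` paths A i j)"

text \<open>\<open>L\<^sup>\<Delta>\<^sub>i\<^sub>j\<close>: the uncertainty set is infinite in general, so the maximum is written as a supremum;
  it is attained when \<open>\<Delta>\<close> is nonempty and compact.\<close>

definition worst_longest ::
  "'j node rel \<Rightarrow> real ^ 'j \<Rightarrow> (real ^ 'j) set \<Rightarrow> 'j node \<Rightarrow> 'j node \<Rightarrow> real" where
  "worst_longest A p \<Delta> i j = (SUP \<delta>\<in>\<Delta>. longest A (p + \<delta>) i j)"

definition critical :: "'j node rel \<Rightarrow> real ^ 'j \<Rightarrow> bool" where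
  "critical A p \<longleftrightarrow>
     (\<forall>vs \<in> paths A Source Sink. path_length p vs = longest A p Source Sink)"

definition anchored_wrt ::
  "'j node rel \<Rightarrow> real ^ 'j \<Rightarrow> (real ^ 'j) set \<Rightarrow> ('j node \<Rightarrow> real) \<Rightarrow> 'j set \<Rightarrow> bool" where
  "anchored_wrt A p \<Delta> x H \<longleftrightarrow>
     (\<forall>\<delta>\<in>\<Delta>. \<exists>y. schedule A (p + \<delta>) y \<and> (\<forall>i\<in>H. y (Job i) = x (Job i)))"

definition anchored ::
  "'j node rel \<Rightarrow> real ^ 'j \<Rightarrow> (real ^ 'j) set \<Rightarrow> real \<Rightarrow> 'j set \<Rightarrow> bool" where
  "anchored A p \<Delta> M H \<longleftrightarrow>
     (\<exists>x. schedule A p x \<and> x Sink \<le> M \<and> anchored_wrt A p \<Delta> x H)"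

definition incidence :: "'j set \<Rightarrow> real ^ 'j" where
  "incidence H = (\<chi> i. indicator H i)"

definition anchored_polytope ::
  "'j::finite node rel \<Rightarrow> real ^ 'j \<Rightarrow> (real ^ 'j) set \<Rightarrow> real \<Rightarrow> (real ^ 'j) set" where
  "anchored_polytope A p \<Delta> M = convex hull (incidence ` {H. anchored A p \<Delta> M H})"

definition P_Dom ::
  "'j node rel \<Rightarrow> real ^ 'j \<Rightarrow> (real ^ 'j) set \<Rightarrow> real
     \<Rightarrow> (('j node \<Rightarrow> real) \<times> (real ^ 'j)) set" where
  "P_Dom A p \<Delta> M =
     {(z, h).
        (\<forall>i. 0 \<le> h $ i \<and> h $ i \<le> 1) \<and>
        (\<forall>(i, j) \<in> A. z j - z i \<ge> ext p i) \<and>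
        z Sink \<le> M \<and>
        (\<forall>i j. prec A i j \<longrightarrow>
           z j - z i \<ge> longest A p i j
             + (worst_longest A p \<Delta> i j - longest A p i j) * ext h j) \<and>
        (\<forall>j. 0 \<le> z j)}"

definition one_disruption :: "real \<Rightarrow> (real ^ 'j::finite) set" where
  "one_disruption d =
     {\<delta>. \<exists>u. \<delta> = (\<chi> i. d * u $ i) \<and> (\<forall>i. 0 \<le> u $ i \<and> u $ i \<le> 1) \<and> (\<Sum>i\<in>UNIV. u $ i) \<le> 1}"

end

theory Submission
  imports Defs
begin

text \<open>Criticality makes every arc tight for the earliest start times: all paths from \<open>s\<close> to a given
  vertex have the same length, so with \<open>lead v = L\<^sub>s\<^sub>v\<close> all \<open>i\<close>-\<open>j\<close> paths have length
  \<open>lead j - lead i\<close>. One disruption of size \<open>d\<close> adds exactly \<open>d\<close> to the longest \<open>i\<close>-\<open>j\<close> path if some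
  job lies on an \<open>i\<close>-\<open>j\<close> path before \<open>j\<close>, and nothing otherwise. The change of variables
  \<open>z v = z s + lead v + d * w v\<close> therefore removes \<open>p\<close> and \<open>d\<close> from the constraints. What is left is a
  vector of delays \<open>w\<close>, starting at \<open>0\<close>, monotone along arcs, at most \<open>M'\<close> at the sink, and
  satisfying \<open>w j - w i \<ge> h j\<close> for the pairs above (\<open>proj_P_Dom_eq_delays\<close>).

  This system is valid in the sense that its incidence vectors are exactly those of the anchored
  sets (\<open>anchored_iff_delays\<close>), and its solutions \<open>h\<close> form a convex set; this gives one inclusion.

  For the other inclusion, a solution \<open>(w, h)\<close> is rounded at random. Draw \<open>t\<close> uniformly
  from \<open>[0, 1)\<close>, replace \<open>w v\<close> by \<open>\<lfloor>w v + t\<rfloor>\<close>, and select the jobs \<open>j\<close> for which the fractional part of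
  \<open>w j + t\<close> is less than \<open>h j\<close>. Rounding keeps monotonicity, and it keeps the bound at the sink because
  \<open>M'\<close> is an integer. A job is selected when an integer lies in \<open>(w j + t - h j, w j + t]\<close>, and this
  integer separates the rounded delay of \<open>j\<close> from that of each constrained \<open>i\<close>, so the selected set is
  anchored (\<open>delays_floor\<close>). Since \<open>j\<close> is selected with probability exactly \<open>h j\<close>
  (\<open>measure_frac_shift_less\<close>), \<open>h\<close> is the mean of incidence vectors of anchored sets
  (\<open>mean_incidence_in_convex_hull\<close>).\<close>

section \<open>Paths in acyclic graphs\<close>

lemma finite_UNIV_node: "finite (UNIV :: 'j::finite node set)"
proof -
  have "UNIV = insert Source (insert Sink (range (Job :: 'j \<Rightarrow> _)))"
    by (metis UNIV_eq_I insertCI node.exhaust rangeI)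
  then show ?thesis
    by (metis finite finite_imageI finite_insert)
qed

text \<open>Consecutive vertices are related by \<open>A\<^sup>+\<close>, so by transitivity all pairs of vertices are, and a
  repetition would be a cycle. Distinctness bounds the length of paths, which is what makes the
  maximum over all paths meaningful.\<close>

lemma distinct_path:
  assumes "acyclic A" "vs \<in> paths A i j"
  shows "distinct vs"
proof -
  have "successively (\<lambda>u v. (u, v) \<in> A\<^sup>+) vs"
    using assms(2) by (auto simp: paths_def elim!: successively_mono)
  moreover have "transp (\<lambda>u v. (u, v) \<in> A\<^sup>+)"
    by (auto intro!: transpI)
  ultimately have "sorted_wrt (\<lambda>u v. (u, v) \<in> A\<^sup>+) vs"
    by (simp add: successively_conv_sorted_wrt)
  then show ?thesis
    using assms(1) by (induction vs) (auto simp: acyclic_def)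
qed

lemma finite_paths:
  fixes A :: "'j::finite node rel"
  assumes "acyclic A"
  shows "finite (paths A i j)"
proof (rule finite_subset)
  show "paths A i j \<subseteq> {vs. set vs \<subseteq> UNIV \<and> length vs \<le> card (UNIV :: 'j node set)}"
    using distinct_path[OF assms]
    by (auto simp: card_mono[OF finite_UNIV_node] simp flip: distinct_card)
qed (rule finite_lists_length_le[OF finite_UNIV_node])

lemma paths_singleton: "[i] \<in> paths A i i"
  by (simp add: paths_def)

lemma paths_append:
  assumes "vs \<in> paths A i j" "us \<in> paths A j k"
  shows "butlast vs @ us \<in> paths A i k"
proof -
  obtain xs where vs: "vs = xs @ [j]"
    using assms(1) by (auto simp: paths_def) (metis append_butlast_last_id)
  obtain ys where us: "us = j # ys"
    using assms(2) by (auto simp: paths_def) (metis list.collapse)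
  show ?thesis
    using assms unfolding vs us
    by (auto simp: paths_def successively_append_iff hd_append split: if_splits)
qed

lemma path_length_append:
  assumes "us \<noteq> []"
  shows "path_length q (butlast vs @ us) = path_length q vs + path_length q us"
  using assms by (simp add: path_length_def butlast_append)

lemma paths_snoc:
  assumes "vs \<in> paths A i j" "(j, k) \<in> A"
  shows "vs @ [k] \<in> paths A i k"
  using assms by (auto simp: paths_def successively_append_iff)

lemma path_length_snoc:
  assumes "vs \<in> paths A i j"
  shows "path_length q (vs @ [k]) = path_length q vs + ext q j"
proof -
  have "vs = butlast vs @ [j]"
    using assms by (auto simp: paths_def)
  then have "sum_list (map (ext q) vs) = sum_list (map (ext q) (butlast vs @ [j]))"
    by simp
  then show ?thesis
    by (simp add: path_length_def)
qed

lemma paths_nonempty_if_reachable: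
  assumes "(i, j) \<in> A\<^sup>*"
  shows "paths A i j \<noteq> {}"
  using assms
proof induction
  case base
  then show ?case using paths_singleton by blast
next
  case (step j k)
  then show ?case using paths_snoc by blast
qed

text \<open>Telescoping along the path. Upper bounds on longest paths are obtained from here by exhibiting
  a potential, and a schedule is one, so no recursion for longest paths is needed.\<close>

lemma path_length_le_potential:
  assumes "\<And>u v. (u, v) \<in> A \<Longrightarrow> ext q u \<le> f v - f u" "vs \<in> paths A i j"
  shows "path_length q vs \<le> f j - f i"
proof -
  have "successively (\<lambda>u v. (u, v) \<in> A) vs \<Longrightarrow> vs \<noteq> [] \<Longrightarrow>
      path_length q vs \<le> f (last vs) - f (hd vs)"
  proof (induction vs rule: induct_list012)
    case (3 x y zs)
    then show ?case
      using assms(1)[of x y] by (auto simp: path_length_def)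
  qed (auto simp: path_length_def)
  then show ?thesis
    using assms(2) by (auto simp: paths_def)
qed

lemma path_length_eq_potential:
  assumes "\<And>u v. (u, v) \<in> A \<Longrightarrow> f v = f u + ext q u" "vs \<in> paths A i j"
  shows "path_length q vs = f j - f i"
proof -
  have "successively (\<lambda>u v. (u, v) \<in> A) vs \<Longrightarrow> vs \<noteq> [] \<Longrightarrow>
      path_length q vs = f (last vs) - f (hd vs)"
  proof (induction vs rule: induct_list012)
    case (3 x y zs)
    then show ?case
      using assms(1)[of x y] by (auto simp: path_length_def)
  qed (auto simp: path_length_def)
  then show ?thesis
    using assms(2) by (auto simp: paths_def)
qed

lemma ext_add: "ext (p + q) v = ext p v + ext q v"
  by (cases v) auto

lemma mono_along_paths:
  fixes w :: "'a \<Rightarrow> real"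
  assumes "\<And>i j. (i, j) \<in> A \<Longrightarrow> w i \<le> w j" "(i, j) \<in> A\<^sup>*"
  shows "w i \<le> w j"
  using assms(2) by induction (use assms(1) order_trans in blast)+

text \<open>Well-founded induction: follow predecessor jobs down to a job that has none, which is
  joined to the source; dually for the sink.\<close>

lemma project_graph_reachable:
  fixes A :: "'j::finite node rel"
  assumes "project_graph A"
  shows reachable_from_Source: "(Source, v) \<in> A\<^sup>*"
    and Sink_reachable: "(v, Sink) \<in> A\<^sup>*"
proof -
  have "finite A"
    by (metis finite_UNIV_node finite_Prod_UNIV finite_subset subset_UNIV)
  then have wf: "wf A" "wf (A\<inverse>)"
    using assms by (auto simp: project_graph_def finite_acyclic_wf finite_acyclic_wf_converse)
  have job_source: "(Source, v) \<in> A\<^sup>*" if "v \<in> range Job" for v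
    using wf(1) that
  proof (induction v rule: wf_induct_rule)
    case (less v)
    then obtain i where v: "v = Job i" by auto
    show ?case
    proof (cases "\<exists>k. (Job k, Job i) \<in> A")
      case True
      then show ?thesis using less v by (metis rangeI rtrancl.rtrancl_into_rtrancl)
    next
      case False
      then show ?thesis using assms v by (auto simp: project_graph_def)
    qed
  qed
  have job_sink: "(v, Sink) \<in> A\<^sup>*" if "v \<in> range Job" for v
    using wf(2) that
  proof (induction v rule: wf_induct_rule)
    case (less v)
    then obtain i where v: "v = Job i" by auto
    show ?case
    proof (cases "\<exists>k. (Job i, Job k) \<in> A")
      case True
      then show ?thesis using less v by (metis converseI converse_rtrancl_into_rtrancl rangeI)
    next
      case False
      then show ?thesis using assms v by (auto simp: project_graph_def)
    qed
  qed
  have st: "(Source, Sink) \<in> A\<^sup>*"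
    using job_source[of "Job undefined"] job_sink[of "Job undefined"] by auto
  show "(Source, v) \<in> A\<^sup>*" "(v, Sink) \<in> A\<^sup>*"
    using job_source job_sink st by (cases v; auto)+
qed

section \<open>Averaging a random set of indices\<close>

text \<open>The mean of the random vector \<open>incidence (S t)\<close>, with \<open>t\<close> uniform on \<open>[0, 1)\<close>. Only finitely many
  sets occur, and the weight of \<open>H\<close> is the measure of the \<open>t\<close> with \<open>S t = H\<close>.\<close>

lemma mean_incidence_in_convex_hull:
  fixes S :: "real \<Rightarrow> 'j::finite set"
  assumes "\<And>j. {t \<in> {0..<1}. j \<in> S t} \<in> sets lborel"
  shows "(\<chi> j. measure lborel {t \<in> {0..<1}. j \<in> S t}) \<in> convex hull (incidence ` S ` {0..<1})"
proof -
  define I where "I = {0..<1::real}"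
  define B where "B H = {t \<in> I. S t = H}" for H
  have B_eq: "B H = I \<inter> (\<Inter>j\<in>UNIV. if j \<in> H then {t \<in> I. j \<in> S t} else I - {t \<in> I. j \<in> S t})" for H
    unfolding B_def by (auto split: if_splits)
  have B_sets: "B H \<in> sets lborel" for H
    unfolding B_eq using assms
    by (intro sets.Int sets.finite_INT) (auto simp: I_def)
  have fin: "emeasure lborel (B H) \<noteq> \<infinity>" for H
  proof -
    have "emeasure lborel (B H) \<le> emeasure lborel I"
      by (intro emeasure_mono) (auto simp: B_def I_def)
    also have "\<dots> < \<infinity>" by (simp add: I_def)
    finally show ?thesis by simp
  qed
  have sum_B: "measure lborel {t \<in> I. P (S t)} = (\<Sum>H | P H. measure lborel (B H))" for P
  proof -
    have "{t \<in> I. P (S t)} = (\<Union>H\<in>{H. P H}. B H)" by (auto simp: B_def)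
    moreover have "measure lborel (\<Union>H\<in>{H. P H}. B H) = (\<Sum>H | P H. measure lborel (B H))"
      using B_sets fin
      by (intro measure_finite_Union) (auto simp: disjoint_family_on_def B_def)
    ultimately show ?thesis by simp
  qed
  have total: "(\<Sum>H\<in>S ` I. measure lborel (B H)) = 1"
  proof -
    have "{t \<in> I. S t \<in> S ` I} = I" by auto
    moreover have "measure lborel I = 1" by (simp add: I_def)
    ultimately show ?thesis using sum_B[of "\<lambda>H. H \<in> S ` I"] by simp
  qed
  have "(\<Sum>H\<in>S ` I. measure lborel (B H) *\<^sub>R incidence H)
      = (\<chi> j. measure lborel {t \<in> I. j \<in> S t})"
  proof (rule vec_eq_iff[THEN iffD2], rule allI)
    fix j
    have "(\<Sum>H\<in>S ` I. measure lborel (B H) *\<^sub>R incidence H) $ j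
        = (\<Sum>H\<in>S ` I. if j \<in> H then measure lborel (B H) else 0)"
      unfolding sum_component by (intro sum.cong) (auto simp: incidence_def indicator_def)
    also have "\<dots> = (\<Sum>H | H \<in> S ` I \<and> j \<in> H. measure lborel (B H))"
      by (rule sum.inter_filter[symmetric]) simp
    also have "\<dots> = measure lborel {t \<in> I. S t \<in> S ` I \<and> j \<in> S t}"
      using sum_B[of "\<lambda>H. H \<in> S ` I \<and> j \<in> H"] by simp
    also have "{t \<in> I. S t \<in> S ` I \<and> j \<in> S t} = {t \<in> I. j \<in> S t}" by auto
    finally show "(\<Sum>H\<in>S ` I. measure lborel (B H) *\<^sub>R incidence H) $ j
        = (\<chi> j. measure lborel {t \<in> I. j \<in> S t}) $ j"
      by simp
  qed
  moreover have "(\<Sum>H\<in>S ` I. measure lborel (B H) *\<^sub>R incidence H)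
      \<in> convex hull (incidence ` S ` I)"
    by (intro convex_sum) (auto simp: total hull_inc)
  ultimately show ?thesis by (simp add: I_def)
qed

text \<open>The circle rotation by \<open>a\<close> pulls an arc of length \<open>c\<close> back to one of the same length, possibly
  cut into two intervals at the origin.\<close>

lemma frac_shift_less_eq:
  fixes a c :: real
  assumes "0 \<le> c" "c \<le> 1"
  shows "{t \<in> {0..<1}. frac (a + t) < c}
    = {0..<c - frac a} \<union> {1 - frac a..<min 1 (1 - frac a + c)}"
proof -
  define b where "b = frac a"
  have b: "0 \<le> b" "b < 1"
    by (simp_all add: b_def frac_lt_1)
  have frac: "frac (a + t) = (if b + t < 1 then b + t else b + t - 1)" if "t \<in> {0..<1}" for t
  proof -
    have "frac t = t" using that by (simp add: frac_eq)
    then show ?thesis by (simp add: frac_add b_def)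
  qed
  have "{t \<in> {0..<1}. frac (a + t) < c}
      = {t \<in> {0..<1}. (if b + t < 1 then b + t else b + t - 1) < c}"
    using frac by auto
  also have "\<dots> = {0..<c - b} \<union> {1 - b..<min 1 (1 - b + c)}"
    using b assms by (auto split: if_splits)
  finally show ?thesis by (simp add: b_def)
qed

lemma measure_frac_shift_less:
  fixes a c :: real
  assumes "0 \<le> c" "c \<le> 1"
  shows "measure lborel {t \<in> {0..<1}. frac (a + t) < c} = c"
proof -
  define b where "b = frac a"
  have b: "0 \<le> b" "b < 1"
    by (simp_all add: b_def frac_lt_1)
  have "measure lborel ({0..<c - b} \<union> {1 - b..<min 1 (1 - b + c)}) = c"
  proof (cases "b \<le> c")
    case True
    have "measure lborel ({0..<c - b} \<union> {1 - b..<1})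
        = measure lborel {0..<c - b} + measure lborel {1 - b..<1}"
      using assms b True by (intro measure_Union) auto
    then show ?thesis using b True by (simp add: min_def)
  next
    case False
    then show ?thesis using assms by (simp add: min_def)
  qed
  then show ?thesis
    unfolding frac_shift_less_eq[OF assms] b_def .
qed

section \<open>Delay vectors and their randomized rounding\<close>

text \<open>For \<open>i \<prec> j\<close> in a project graph this fails only if \<open>i\<close> is the source and no job precedes \<open>j\<close>: the
  only path is then a single arc of length \<open>0\<close>.\<close>

definition disruptable :: "'j node rel \<Rightarrow> 'j node \<Rightarrow> 'j node \<Rightarrow> bool" where
  "disruptable A i j \<longleftrightarrow> (\<exists>f. (i, Job f) \<in> A\<^sup>* \<and> (Job f, j) \<in> A\<^sup>+)"

text \<open>The number \<open>w v\<close> is the delay of \<open>v\<close> beyond its earliest start, measured in units of the deviation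
  \<open>d\<close>.\<close>

definition delays :: "'j node rel \<Rightarrow> real \<Rightarrow> real ^ 'j \<Rightarrow> ('j node \<Rightarrow> real) \<Rightarrow> bool" where
  "delays A D h w \<longleftrightarrow>
     w Source = 0 \<and> w Sink \<le> D \<and> (\<forall>(i, j) \<in> A. w i \<le> w j) \<and>
     (\<forall>i j. disruptable A i (Job j) \<longrightarrow> h $ j \<le> w (Job j) - w i)"

text \<open>Where the integrality of the bound at the sink enters: \<open>w Sink + t < m + 1\<close> is rounded
  down to at most \<open>m\<close>.\<close>

lemma delays_floor:
  assumes "delays A (of_int m) h w" "0 \<le> t" "t < 1"
  shows "delays A (of_int m) (incidence {j. frac (w (Job j) + t) < h $ j})
    (\<lambda>v. of_int \<lfloor>w v + t\<rfloor>)"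
proof -
  have "of_int \<lfloor>w i + t\<rfloor> + 1 \<le> (of_int \<lfloor>w (Job j) + t\<rfloor> :: real)"
    if "disruptable A i (Job j)" "frac (w (Job j) + t) < h $ j" for i j
  proof -
    \<comment> \<open>The integer \<open>\<lfloor>w j + t\<rfloor>\<close> exceeds \<open>w j + t - h j\<close>, which is at least \<open>w i + t\<close>.\<close>
    have "w i + t < of_int \<lfloor>w (Job j) + t\<rfloor>"
    proof -
      have "h $ j \<le> w (Job j) - w i"
        using assms(1) that(1) by (simp add: delays_def)
      then show ?thesis using that(2) by (simp add: frac_def)
    qed
    then have "\<lfloor>w i + t\<rfloor> + 1 \<le> \<lfloor>w (Job j) + t\<rfloor>"
      by (metis add1_zle_eq floor_less_iff)
    then have "real_of_int (\<lfloor>w i + t\<rfloor> + 1) \<le> real_of_int \<lfloor>w (Job j) + t\<rfloor>"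
      by (simp only: of_int_le_iff)
    then show ?thesis by simp
  qed
  moreover have "\<lfloor>w Source + t\<rfloor> = 0"
    using assms by (simp add: delays_def floor_eq_iff)
  moreover have "\<lfloor>w Sink + t\<rfloor> \<le> m"
    using assms by (simp add: delays_def floor_le_iff)
  moreover have "\<lfloor>w i + t\<rfloor> \<le> \<lfloor>w (Job j) + t\<rfloor>" if "disruptable A i (Job j)" for i j
  proof -
    have "(i, Job j) \<in> A\<^sup>*"
      using that by (auto simp: disruptable_def)
    then have "w i \<le> w (Job j)"
      by (rule mono_along_paths[rotated]) (use assms(1) in \<open>auto simp: delays_def\<close>)
    then show ?thesis by (intro floor_mono) simp
  qed
  ultimately show ?thesis
    using assms unfolding delays_def incidence_def
    by (auto simp: indicator_def le_diff_eq add.commute intro!: floor_mono)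
qed

lemma convex_delays: "convex {h. (\<forall>i. 0 \<le> h $ i \<and> h $ i \<le> 1) \<and> (\<exists>w. delays A D h w)}"
proof (rule convexI)
  fix g h :: "real ^ 'a" and a b :: real
  assume ab: "0 \<le> a" "0 \<le> b" "a + b = 1"
    and g: "g \<in> {h. (\<forall>i. 0 \<le> h $ i \<and> h $ i \<le> 1) \<and> (\<exists>w. delays A D h w)}"
    and h: "h \<in> {h. (\<forall>i. 0 \<le> h $ i \<and> h $ i \<le> 1) \<and> (\<exists>w. delays A D h w)}"
  obtain v w where v: "delays A D g v" and w: "delays A D h w"
    using g h by auto
  have comb: "a * x + b * y \<le> a * x' + b * y'" if "x \<le> x'" "y \<le> y'" for x x' y y'
    using ab that by (intro add_mono mult_left_mono)
  have comb1: "a * x + b * y \<le> c" if "x \<le> c" "y \<le> c" for x y c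
    using ab that by (metis convex_bound_le)
  have "delays A D (a *\<^sub>R g + b *\<^sub>R h) (\<lambda>x. a * v x + b * w x)"
    unfolding delays_def
  proof (intro conjI allI impI ballI, goal_cases)
    case (4 i j)
    then have "a * g $ j + b * h $ j \<le> a * (v (Job j) - v i) + b * (w (Job j) - w i)"
      using v w by (intro comb) (auto simp: delays_def)
    then show ?case by (simp add: algebra_simps)
  next
    case (3 e)
    then show ?case
      using v w by (auto simp: delays_def split: prod.splits intro!: comb)
  qed (use v w in \<open>auto simp: delays_def intro!: comb1\<close>)
  moreover have "0 \<le> (a *\<^sub>R g + b *\<^sub>R h) $ i \<and> (a *\<^sub>R g + b *\<^sub>R h) $ i \<le> 1" for i
    using g h ab by (auto intro!: comb1 add_nonneg_nonneg)
  ultimately show "a *\<^sub>R g + b *\<^sub>R h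
      \<in> {h. (\<forall>i. 0 \<le> h $ i \<and> h $ i \<le> 1) \<and> (\<exists>w. delays A D h w)}"
    by blast
qed

text \<open>Every feasible \<open>h\<close> is the mean of the roundings of \<open>delays_floor\<close>; the converse is convexity.\<close>

lemma delays_integrality:
  fixes A :: "'j::finite node rel" and m :: int
  shows "{h. (\<forall>i. 0 \<le> h $ i \<and> h $ i \<le> 1) \<and> (\<exists>w. delays A (of_int m) h w)}
    = convex hull (incidence ` {H. \<exists>w. delays A (of_int m) (incidence H) w})" (is "?R = ?C")
proof
  show "?R \<subseteq> ?C"
  proof
    fix h assume "h \<in> ?R"
    then obtain w where h: "\<And>i. 0 \<le> h $ i" "\<And>i. h $ i \<le> 1" and w: "delays A (of_int m) h w"
      by auto
    define S where "S t = {j. frac (w (Job j) + t) < h $ j}" for t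
    have S: "(\<chi> j. measure lborel {t \<in> {0..<1}. j \<in> S t}) = h"
      unfolding S_def mem_Collect_eq using h by (simp add: measure_frac_shift_less vec_eq_iff del: atLeastLessThan_iff)
    have "{t \<in> {0..<1}. j \<in> S t} \<in> sets lborel" for j
      unfolding S_def mem_Collect_eq frac_shift_less_eq[OF h] by simp
    then have "h \<in> convex hull (incidence ` S ` {0..<1})"
      using mean_incidence_in_convex_hull[of S] unfolding S by blast
    also have "\<dots> \<subseteq> ?C"
    proof (intro hull_mono image_mono subsetI)
      fix H assume "H \<in> S ` {0..<1}"
      then show "H \<in> {H. \<exists>w. delays A (of_int m) (incidence H) w}"
        using delays_floor[OF w] unfolding S_def by fastforce
    qed
    finally show "h \<in> ?C" .
  qed
  show "?C \<subseteq> ?R"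
    by (intro hull_minimal convex_delays) (auto simp: incidence_def)
qed

section \<open>Critical projects under one disruption\<close>

locale critical_project =
  fixes A :: "'j::finite node rel" and p :: "real ^ 'j"
  assumes graph: "project_graph A"
    and p_nonneg: "0 \<le> p $ i"
    and critical: "critical A p"
begin

lemma acyclic_A: "acyclic A"
  using graph by (simp add: project_graph_def)

lemma finite_paths_A: "finite (paths A i j)"
  by (rule finite_paths[OF acyclic_A])

lemma prec_iff_trancl: "prec A i j \<longleftrightarrow> (i, j) \<in> A\<^sup>+"
  using acyclic_A by (auto simp: prec_def acyclic_def rtrancl_eq_or_trancl)

definition lead :: "'j node \<Rightarrow> real" where
  "lead v = longest A p Source v"

text \<open>Both paths extend to the sink by the same tail, and criticality compares the extensions.\<close>

lemma path_length_from_Source_unique: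
  assumes "vs \<in> paths A Source v" "us \<in> paths A Source v"
  shows "path_length p vs = path_length p us"
proof -
  obtain ts where ts: "ts \<in> paths A v Sink"
    using paths_nonempty_if_reachable[OF Sink_reachable[OF graph]] by blast
  then have "ts \<noteq> []" by (simp add: paths_def)
  moreover have "path_length p (butlast vs @ ts) = path_length p (butlast us @ ts)"
    using critical paths_append[OF assms(1) ts] paths_append[OF assms(2) ts]
    by (auto simp: critical_def)
  ultimately show ?thesis by (simp add: path_length_append)
qed

lemma lead_eq_path_length:
  assumes "vs \<in> paths A Source v"
  shows "lead v = path_length p vs"
proof -
  have "path_length p ` paths A Source v = {path_length p vs}"
    using assms path_length_from_Source_unique by blast
  then show ?thesis by (simp add: lead_def longest_def)
qed

lemma lead_Source: "lead Source = 0"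
  using lead_eq_path_length[OF paths_singleton] by (simp add: path_length_def)

lemma lead_arc:
  assumes "(i, j) \<in> A"
  shows "lead j = lead i + ext p i"
proof -
  obtain vs where "vs \<in> paths A Source i"
    using paths_nonempty_if_reachable[OF reachable_from_Source[OF graph]] by blast
  then show ?thesis
    using lead_eq_path_length paths_snoc[OF _ assms] path_length_snoc by metis
qed

lemma lead_nonneg: "0 \<le> lead v"
proof -
  have "0 \<le> ext p v" for v by (cases v) (auto simp: p_nonneg)
  then have "lead Source \<le> lead v"
    by (intro mono_along_paths[OF _ reachable_from_Source[OF graph]]) (simp add: lead_arc)
  then show ?thesis by (simp add: lead_Source)
qed

lemma longest_eq_lead:
  assumes "prec A i j"
  shows "longest A p i j = lead j - lead i"
proof -
  have "paths A i j \<noteq> {}"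
    using assms by (auto simp: prec_def intro!: paths_nonempty_if_reachable)
  moreover have "path_length p vs = lead j - lead i" if "vs \<in> paths A i j" for vs
    by (rule path_length_eq_potential[OF lead_arc that])
  ultimately have "path_length p ` paths A i j = {lead j - lead i}"
    by (simp add: image_constant_conv cong: image_cong)
  then show ?thesis by (simp add: longest_def)
qed

text \<open>Arcs are tight for \<open>lead\<close>, so processing times drop out of the precedence constraints.\<close>

lemma arc_constraints_iff_mono_delay:
  assumes "d > 0"
  shows "(\<forall>(i, j) \<in> A. ext p i \<le> (lead j + d * w j) - (lead i + d * w i))
    \<longleftrightarrow> (\<forall>(i, j) \<in> A. w i \<le> w j)"
proof -
  have iff: "ext p i \<le> (lead j + d * w j) - (lead i + d * w i) \<longleftrightarrow> w i \<le> w j"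
    if "(i, j) \<in> A" for i j
  proof -
    have "(lead j + d * w j) - (lead i + d * w i) = ext p i + d * (w j - w i)"
      by (simp add: lead_arc[OF that] algebra_simps)
    then show ?thesis using assms by (simp add: zero_le_mult_iff)
  qed
  show ?thesis
    by (rule ball_cong[OF refl]) (clarsimp simp: iff)
qed

text \<open>A potential for the extra length \<open>\<delta>\<close>: simpler than the longest path from the source under
  \<open>\<delta>\<close>, and still at most \<open>d\<close> because the total deviation is.\<close>

definition disruption_before :: "real ^ 'j \<Rightarrow> 'j node \<Rightarrow> real" where
  "disruption_before \<delta> v = (\<Sum>f | (Job f, v) \<in> A\<^sup>+. \<delta> $ f)"

lemma disruption_before_nonneg:
  assumes "\<And>f. 0 \<le> \<delta> $ f"
  shows "0 \<le> disruption_before \<delta> v"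
  by (simp add: disruption_before_def assms sum_nonneg)

lemma disruption_before_arc:
  assumes "\<And>f. 0 \<le> \<delta> $ f" "(i, j) \<in> A"
  shows "disruption_before \<delta> i + ext \<delta> i \<le> disruption_before \<delta> j"
proof -
  have sub: "{f. (Job f, i) \<in> A\<^sup>+} \<subseteq> {f. (Job f, j) \<in> A\<^sup>+}"
    using trancl_into_trancl[OF _ assms(2)] by (rule Collect_mono[OF impI])
  show ?thesis
  proof (cases "i \<in> range Job")
    case True
    then obtain f where i: "i = Job f" by blast
    have "f \<notin> {f. (Job f, i) \<in> A\<^sup>+}"
      using acyclic_A i by (simp add: acyclic_def)
    then have "disruption_before \<delta> i + ext \<delta> i
        = (\<Sum>f\<in>insert f {f. (Job f, i) \<in> A\<^sup>+}. \<delta> $ f)"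
      by (simp add: disruption_before_def i)
    also have "\<dots> \<le> disruption_before \<delta> j"
      unfolding disruption_before_def
    proof (rule sum_mono2)
      show "insert f {f. (Job f, i) \<in> A\<^sup>+} \<subseteq> {f. (Job f, j) \<in> A\<^sup>+}"
        using sub assms(2) i by blast
    qed (rule finite, rule assms(1))
    finally show ?thesis .
  next
    case False
    then have "ext \<delta> i = 0" by (cases i) auto
    moreover have "disruption_before \<delta> i \<le> disruption_before \<delta> j"
      unfolding disruption_before_def by (rule sum_mono2[OF _ sub]) (rule finite, rule assms(1))
    ultimately show ?thesis by simp
  qed
qed

end

lemma one_disruption_nonneg:
  assumes "d > 0" "\<delta> \<in> one_disruption d"
  shows "0 \<le> \<delta> $ f"
  using assms by (auto simp: one_disruption_def)

lemma one_disruption_axis: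
  assumes "d > 0"
  shows "axis f d \<in> one_disruption d"
  unfolding one_disruption_def
  by (auto intro!: exI[of _ "axis f 1"] simp: axis_def vec_eq_iff)

lemma one_disruption_zero: "0 \<in> one_disruption d"
  unfolding one_disruption_def by (auto intro!: exI[of _ 0] simp: vec_eq_iff)

lemma ext_axis: "ext (axis f c) v = (if v = Job f then c else 0)"
  by (cases v) (auto simp: axis_def)

locale disrupted_critical_project = critical_project A p
  for A :: "'j::finite node rel" and p +
  fixes d :: real
  assumes d_pos: "d > 0"
begin

lemma disruption_before_le:
  assumes "\<delta> \<in> one_disruption d"
  shows "disruption_before \<delta> v \<le> d"
proof -
  have "disruption_before \<delta> v \<le> (\<Sum>f\<in>UNIV. \<delta> $ f)"
    unfolding disruption_before_def
    by (rule sum_mono2[OF finite subset_UNIV one_disruption_nonneg[OF d_pos assms]])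
  also have "\<dots> \<le> d"
  proof -
    obtain u where "\<delta> = (\<chi> i. d * u $ i)" "(\<Sum>i\<in>UNIV. u $ i) \<le> 1"
      using assms by (auto simp: one_disruption_def)
    then show ?thesis
      using d_pos by (simp flip: sum_distrib_left)
  qed
  finally show ?thesis .
qed

lemma disruptable_if_disruption_before:
  assumes "prec A i j" "(Job f, j) \<in> A\<^sup>+"
  shows "disruptable A i j"
proof (cases i)
  case Source
  then show ?thesis
    using assms(2) reachable_from_Source[OF graph] by (auto simp: disruptable_def)
next
  case Sink
  have "(Sink, j) \<in> A\<^sup>+"
    using assms(1) Sink by (simp add: prec_iff_trancl)
  then obtain k where "(Sink, k) \<in> A"
    by (meson tranclD)
  then show ?thesis
    using graph by (simp add: project_graph_def)
next
  case (Job k)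
  then show ?thesis
    using assms(1) by (auto simp: disruptable_def prec_iff_trancl)
qed

text \<open>The potential is \<open>lead\<close> plus \<open>disruption_before \<delta>\<close>; the second summand lies between \<open>0\<close> and \<open>d\<close>,
  and vanishes at \<open>j\<close> when no job precedes \<open>j\<close>.\<close>

lemma disrupted_path_length_le:
  assumes "\<delta> \<in> one_disruption d" "prec A i j" "vs \<in> paths A i j"
  shows "path_length (p + \<delta>) vs \<le> lead j - lead i + (if disruptable A i j then d else 0)"
proof -
  note nonneg = one_disruption_nonneg[OF d_pos assms(1)]
  have "path_length (p + \<delta>) vs
      \<le> (lead j + disruption_before \<delta> j) - (lead i + disruption_before \<delta> i)"
  proof (rule path_length_le_potential[OF _ assms(3)])
    fix u v assume arc: "(u, v) \<in> A"
    show "ext (p + \<delta>) u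
        \<le> (lead v + disruption_before \<delta> v) - (lead u + disruption_before \<delta> u)"
      using lead_arc[OF arc] disruption_before_arc[OF nonneg arc] unfolding ext_add by linarith
  qed
  moreover have "disruption_before \<delta> j = 0" if "\<not> disruptable A i j"
  proof -
    have "{f. (Job f, j) \<in> A\<^sup>+} = {}"
      using that disruptable_if_disruption_before[OF assms(2)] by blast
    then show ?thesis by (simp add: disruption_before_def)
  qed
  ultimately show ?thesis
    using disruption_before_le[OF assms(1), of j] disruption_before_nonneg[OF nonneg, of i]
    by auto
qed

text \<open>Spend the whole deviation on a job \<open>f\<close> and take a path through \<open>f\<close> that continues after it, so
  that an arc of length \<open>p\<^sub>f + d\<close> is used.\<close>

lemma disrupted_path_exists:
  assumes "(i, Job f) \<in> A\<^sup>*" "(Job f, j) \<in> A\<^sup>+"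
  shows "\<exists>vs \<in> paths A i j. lead j - lead i + d \<le> path_length (p + axis f d) vs"
proof -
  obtain k where k: "(Job f, k) \<in> A" "(k, j) \<in> A\<^sup>*"
    using assms(2) by (meson tranclD)
  obtain vs where vs: "vs \<in> paths A i (Job f)"
    using paths_nonempty_if_reachable[OF assms(1)] by blast
  obtain us where us: "us \<in> paths A k j"
    using paths_nonempty_if_reachable[OF k(2)] by blast
  then have "us \<noteq> []" by (simp add: paths_def)
  have ge: "path_length p xs \<le> path_length (p + axis f d) xs" for xs
    unfolding path_length_def using d_pos by (intro sum_list_mono) (simp add: ext_add ext_axis)
  have path: "butlast (vs @ [k]) @ us \<in> paths A i j"
    by (rule paths_append[OF paths_snoc[OF vs k(1)] us])
  have "path_length (p + axis f d) (butlast (vs @ [k]) @ us)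
      = path_length (p + axis f d) vs + p $ f + d + path_length (p + axis f d) us"
    by (simp add: path_length_append[OF \<open>us \<noteq> []\<close>] path_length_snoc[OF vs] ext_add ext_axis
        del: butlast_snoc)
  also have "\<dots> \<ge> path_length p vs + p $ f + d + path_length p us"
    using ge by (simp add: add_mono)
  also have "path_length p vs + p $ f + d + path_length p us
      = (lead (Job f) - lead i) + p $ f + d + (lead j - lead k)"
    using path_length_eq_potential[OF lead_arc vs] path_length_eq_potential[OF lead_arc us] by simp
  finally have "lead j - lead i + d \<le> path_length (p + axis f d) (butlast (vs @ [k]) @ us)"
    using lead_arc[OF k(1)] by simp
  then show ?thesis
    using path by blast
qed

lemma worst_longest_minus_longest:
  assumes "prec A i j"
  shows "worst_longest A p (one_disruption d) i j - longest A p i j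
    = (if disruptable A i j then d else 0)" (is "_ = ?e")
proof -
  have ne: "paths A i j \<noteq> {}"
    using assms by (auto simp: prec_def intro!: paths_nonempty_if_reachable)
  have upper: "longest A (p + \<delta>) i j \<le> lead j - lead i + ?e" if "\<delta> \<in> one_disruption d" for \<delta>
    unfolding longest_def using ne finite_paths_A disrupted_path_length_le[OF that assms]
    by (subst Max_le_iff) auto
  have "\<exists>\<delta>\<in>one_disruption d. lead j - lead i + ?e \<le> longest A (p + \<delta>) i j"
  proof (cases "disruptable A i j")
    case True
    then obtain f vs where "vs \<in> paths A i j"
        "lead j - lead i + d \<le> path_length (p + axis f d) vs"
      using disrupted_path_exists by (meson disruptable_def)
    then have "lead j - lead i + d \<le> longest A (p + axis f d) i j"
      unfolding longest_def using finite_paths_A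
      by (meson Max_ge finite_imageI imageI order_trans)
    then show ?thesis
      using True one_disruption_axis[OF d_pos] by auto
  next
    case False
    then show ?thesis
      using one_disruption_zero longest_eq_lead[OF assms] by (auto intro!: bexI[of _ 0])
  qed
  then obtain \<delta> where \<delta>: "\<delta> \<in> one_disruption d"
      "lead j - lead i + ?e \<le> longest A (p + \<delta>) i j" by blast
  have "worst_longest A p (one_disruption d) i j = lead j - lead i + ?e"
    unfolding worst_longest_def
  proof (rule antisym)
    show "(SUP \<delta>\<in>one_disruption d. longest A (p + \<delta>) i j) \<le> lead j - lead i + ?e"
      using one_disruption_zero upper by (intro cSUP_least) auto
    show "lead j - lead i + ?e \<le> (SUP \<delta>\<in>one_disruption d. longest A (p + \<delta>) i j)"
    proof (rule cSUP_upper2)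
      show "bdd_above ((\<lambda>\<delta>. longest A (p + \<delta>) i j) ` one_disruption d)"
        using upper by (rule bdd_aboveI2)
    qed (use \<delta> in auto)
  qed
  then show ?thesis by (simp add: longest_eq_lead[OF assms])
qed

lemma disruptable_imp_prec: "disruptable A i j \<Longrightarrow> prec A i j"
  by (auto simp: disruptable_def prec_iff_trancl)

text \<open>The change of variables \<open>z v = z s + lead v + d * w v\<close>. Subtracting \<open>z s\<close> is needed because the
  relaxation only asks for \<open>z s \<ge> 0\<close>; it makes the bound at the sink only easier to satisfy.\<close>

lemma proj_P_Dom_eq_delays:
  "snd ` P_Dom A p (one_disruption d) (lead Sink + d * D)
    = {h. (\<forall>i. 0 \<le> h $ i \<and> h $ i \<le> 1) \<and> (\<exists>w. delays A D h w)}" (is "?L = ?R")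
proof
  show "?L \<subseteq> ?R"
  proof
    fix h assume "h \<in> ?L"
    then obtain z where z: "(z, h) \<in> P_Dom A p (one_disruption d) (lead Sink + d * D)"
      by auto
    define w where "w v = (z v - z Source - lead v) / d" for v
    have zw: "z v = z Source + lead v + d * w v" for v
      using d_pos by (simp add: w_def)
    have "w Source = 0" by (simp add: w_def lead_Source)
    moreover have "w Sink \<le> D"
    proof -
      have "z Sink \<le> lead Sink + d * D" "0 \<le> z Source"
        using z by (auto simp: P_Dom_def)
      then have "d * w Sink \<le> d * D" unfolding zw[of Sink] by simp
      then show ?thesis using d_pos by simp
    qed
    moreover have "\<forall>(i, j)\<in>A. w i \<le> w j"
      using z unfolding arc_constraints_iff_mono_delay[OF d_pos, symmetric]
      by (auto simp: P_Dom_def w_def d_pos)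
         (use d_pos in \<open>fastforce simp: field_simps\<close>)
    moreover have "h $ j \<le> w (Job j) - w i" if "disruptable A i (Job j)" for i j
    proof -
      note prec = disruptable_imp_prec[OF that]
      have "longest A p i (Job j)
          + (worst_longest A p (one_disruption d) i (Job j) - longest A p i (Job j)) * h $ j
          \<le> z (Job j) - z i"
        using z prec by (fastforce simp: P_Dom_def)
      then have "d * h $ j \<le> d * (w (Job j) - w i)"
        using that unfolding worst_longest_minus_longest[OF prec] unfolding longest_eq_lead[OF prec]
          zw[of i] zw[of "Job j"] by (simp add: algebra_simps)
      then show ?thesis using d_pos by simp
    qed
    ultimately have "delays A D h w" by (simp add: delays_def)
    moreover have "\<forall>i. 0 \<le> h $ i \<and> h $ i \<le> 1"
      using z by (simp add: P_Dom_def)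
    ultimately show "h \<in> ?R" by blast
  qed
  show "?R \<subseteq> ?L"
  proof
    fix h assume "h \<in> ?R"
    then obtain w where h: "\<forall>i. 0 \<le> h $ i \<and> h $ i \<le> 1" and w: "delays A D h w"
      by auto
    have mono: "w i \<le> w j" if "(i, j) \<in> A\<^sup>*" for i j
      using that by (rule mono_along_paths[rotated]) (use w in \<open>auto simp: delays_def\<close>)
    define z where "z v = lead v + d * w v" for v
    have "longest A p i j
        + (worst_longest A p (one_disruption d) i j - longest A p i j) * ext h j \<le> z j - z i"
      if prec: "prec A i j" for i j
    proof -
      have "(if disruptable A i j then 1 else 0) * ext h j \<le> w j - w i"
        using w mono[of i j] prec by (cases j) (auto simp: delays_def prec_def)
      then have "d * ((if disruptable A i j then 1 else 0) * ext h j) \<le> d * (w j - w i)"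
        using d_pos by simp
      then show ?thesis
        unfolding worst_longest_minus_longest[OF prec] unfolding longest_eq_lead[OF prec]
        by (auto simp: z_def algebra_simps split: if_splits)
    qed
    moreover have "0 \<le> z v" for v
      using mono[OF reachable_from_Source[OF graph]] w lead_nonneg d_pos
      by (simp add: z_def delays_def)
    moreover have "\<forall>(i, j)\<in>A. ext p i \<le> z j - z i"
      using w unfolding z_def arc_constraints_iff_mono_delay[OF d_pos] by (simp add: delays_def)
    moreover have "z Sink \<le> lead Sink + d * D"
      using w d_pos by (simp add: z_def delays_def)
    ultimately have "(z, h) \<in> P_Dom A p (one_disruption d) (lead Sink + d * D)"
      using h by (simp add: P_Dom_def)
    then show "h \<in> ?L" by force
  qed
qed

lemma schedule_difference_ge_disrupted:
  assumes "schedule A (p + axis f d) y" "(i, Job f) \<in> A\<^sup>*" "(Job f, j) \<in> A\<^sup>+"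
  shows "lead j - lead i + d \<le> y j - y i"
proof -
  obtain vs where "vs \<in> paths A i j" "lead j - lead i + d \<le> path_length (p + axis f d) vs"
    using disrupted_path_exists[OF assms(2,3)] by blast
  moreover have "path_length (p + axis f d) vs \<le> y j - y i"
    by (rule path_length_le_potential[OF _ \<open>vs \<in> paths A i j\<close>])
      (use assms(1) in \<open>auto simp: schedule_def\<close>)
  ultimately show ?thesis by linarith
qed

text \<open>From a schedule that anchors \<open>H\<close>, the delays of jobs outside \<open>H\<close> are first pushed down as far as
  the source and \<open>H\<close> allow. Without this a late job outside \<open>H\<close> could violate the constraint towards
  an anchored job that comes after it; afterwards each delay is inherited from an anchored job or the
  source, and the gap \<open>d\<close> to a later anchored job is witnessed by the schedule under the disruption of
  a job between the two.

  Conversely, a disruption \<open>\<delta>\<close> is absorbed by postponing every job outside \<open>H\<close> by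
  \<open>disruption_before \<delta>\<close>, at most \<open>d\<close>, and the unit gaps in front of anchored jobs have room for it.\<close>

lemma anchored_iff_delays:
  "anchored A p (one_disruption d) (lead Sink + d * D) H
    \<longleftrightarrow> (\<exists>w. delays A D (incidence H) w)"
proof
  assume "anchored A p (one_disruption d) (lead Sink + d * D) H"
  then obtain x where x: "schedule A p x" "x Sink \<le> lead Sink + d * D"
    and anch: "anchored_wrt A p (one_disruption d) x H"
    by (auto simp: anchored_def)
  define w where "w v = (x v - lead v) / d" for v
  have xw: "x v = lead v + d * w v" for v
    using d_pos by (simp add: w_def)
  have w_arc: "\<forall>(i, j)\<in>A. w i \<le> w j"
    using x(1) unfolding arc_constraints_iff_mono_delay[OF d_pos, symmetric] xw[symmetric]
    by (simp add: schedule_def)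
  have mono: "w i \<le> w j" if "(i, j) \<in> A\<^sup>*" for i j
    using that by (rule mono_along_paths[rotated]) (use w_arc in auto)
  \<comment> \<open>\<open>v i\<close> is the least monotone delay that agrees with \<open>w\<close> on the source and \<open>H\<close>.\<close>
  define K where "K v = {k \<in> insert Source (Job ` H). (k, v) \<in> A\<^sup>*}" for v
  define v where "v i = Max (w ` K i)" for i
  have fin: "finite (K i)" and ne: "K i \<noteq> {}" for i
    using reachable_from_Source[OF graph] by (auto simp: K_def)
  have v_le: "v i \<le> w i" for i
    unfolding v_def using fin ne mono by (subst Max_le_iff) (auto simp: K_def)
  have v_ge: "w k \<le> v i" if "k \<in> K i" for i k
    unfolding v_def using fin that by simp
  have v_in: "\<exists>k\<in>K i. v i = w k" for i
  proof -
    have "Max (w ` K i) \<in> w ` K i" using fin ne by (intro Max_in) auto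
    then show ?thesis by (auto simp: v_def)
  qed
  have v_eq: "v i = w i" if "i \<in> insert Source (Job ` H)" for i
    using that v_le v_ge[of i i] by (intro antisym) (auto simp: K_def)
  have w0: "w Source = 0"
    using x(1) by (simp add: w_def schedule_def lead_Source)
  have v_arc: "v i \<le> v j" if "(i, j) \<in> A" for i j
  proof -
    obtain k where "k \<in> K i" "v i = w k" using v_in by blast
    moreover have "k \<in> K j" using \<open>k \<in> K i\<close> that by (auto simp: K_def)
    ultimately show ?thesis using v_ge by simp
  qed
  have "incidence H $ j \<le> v (Job j) - v i" if dis: "disruptable A i (Job j)" for i j
  proof (cases "j \<in> H")
    case True
    obtain f where f: "(i, Job f) \<in> A\<^sup>*" "(Job f, Job j) \<in> A\<^sup>+"
      using dis by (auto simp: disruptable_def)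
    obtain k where k: "k \<in> K i" "v i = w k" using v_in by blast
    obtain y where y: "schedule A (p + axis f d) y" "\<forall>i\<in>H. y (Job i) = x (Job i)"
      using anch one_disruption_axis[OF d_pos, of f] unfolding anchored_wrt_def by blast
    have "lead (Job j) - lead k + d \<le> y (Job j) - y k"
      by (rule schedule_difference_ge_disrupted[OF y(1) _ f(2)]) (use k f in \<open>auto simp: K_def\<close>)
    moreover have "y (Job j) = x (Job j)" using True y by auto
    moreover have "y k = x k"
      using k y x by (auto simp: K_def schedule_def)
    ultimately have "d * 1 \<le> d * (w (Job j) - w k)"
      unfolding xw by (simp add: algebra_simps)
    then have "1 \<le> w (Job j) - w k" using d_pos by (simp only: mult_le_cancel_left_pos)
    then show ?thesis using True k v_eq by (simp add: incidence_def)
  next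
    case False
    have "(i, Job j) \<in> A\<^sup>*"
      using disruptable_imp_prec[OF dis] by (simp add: prec_def)
    then have "v i \<le> v (Job j)"
      by (rule mono_along_paths[rotated]) (rule v_arc)
    then show ?thesis using False by (simp add: incidence_def)
  qed
  moreover have "v Sink \<le> D"
  proof -
    have "d * w Sink \<le> d * D" using x(2) unfolding xw by simp
    then show ?thesis using d_pos v_le[of Sink] by simp
  qed
  ultimately have "delays A D (incidence H) v"
    using v_arc v_eq[of Source] w0 by (auto simp: delays_def)
  then show "\<exists>w. delays A D (incidence H) w" by blast
next
  assume "\<exists>w. delays A D (incidence H) w"
  then obtain w where w: "delays A D (incidence H) w" by blast
  have mono: "w i \<le> w j" if "(i, j) \<in> A\<^sup>*" for i j
    using that by (rule mono_along_paths[rotated]) (use w in \<open>auto simp: delays_def\<close>)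
  have w_nonneg: "0 \<le> w v" for v
    using mono[OF reachable_from_Source[OF graph]] w by (simp add: delays_def)
  define x where "x v = lead v + d * w v" for v
  have x_nonneg: "0 \<le> x v" for v
    using w_nonneg lead_nonneg d_pos by (simp add: x_def)
  have x0: "x Source = 0" using w by (simp add: x_def delays_def lead_Source)
  have "schedule A p x"
    using x_nonneg x0 w unfolding schedule_def x_def arc_constraints_iff_mono_delay[OF d_pos]
    by (auto simp: delays_def)
  moreover have "x Sink \<le> lead Sink + d * D"
    using w d_pos by (simp add: x_def delays_def)
  moreover have "anchored_wrt A p (one_disruption d) x H"
    unfolding anchored_wrt_def
  proof
    fix \<delta> :: "real ^ 'j" assume \<delta>: "\<delta> \<in> one_disruption d"
    note nonneg = one_disruption_nonneg[OF d_pos \<delta>]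
    define r where "r v = (if v \<in> insert Source (Job ` H) then 0 else disruption_before \<delta> v)" for v
    have r: "0 \<le> r v" "r v \<le> disruption_before \<delta> v" for v
      using disruption_before_nonneg[OF nonneg] by (auto simp: r_def)
    have delay: "d * w i + r i + ext \<delta> i \<le> d * w j + r j" if arc: "(i, j) \<in> A" for i j
    proof -
      have step: "r i + ext \<delta> i \<le> disruption_before \<delta> j"
        using r(2)[of i] disruption_before_arc[OF nonneg arc] by linarith
      have j: "j \<noteq> Source" using arc graph by (auto simp: project_graph_def)
      have wij: "d * w i \<le> d * w j" using mono[OF r_into_rtrancl[OF arc]] d_pos by simp
      show ?thesis
      proof (cases "j \<in> Job ` H")
        case True
        then obtain b where b: "j = Job b" "b \<in> H" by auto
        show ?thesis
        proof (cases "disruptable A i j")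
          case dis: True
          then have "1 \<le> w j - w i"
            using w b by (fastforce simp: delays_def incidence_def)
          then have "d * 1 \<le> d * (w j - w i)"
            using d_pos by (simp only: mult_le_cancel_left_pos)
          then show ?thesis
            using step disruption_before_le[OF \<delta>, of j] r(1)[of j] by (simp add: algebra_simps)
        next
          case False
          have "prec A i j" using arc by (auto simp: prec_iff_trancl)
          then have "{f. (Job f, j) \<in> A\<^sup>+} = {}"
            using False disruptable_if_disruption_before by blast
          then show ?thesis
            using step wij r(1)[of j] by (simp add: disruption_before_def)
        qed
      next
        case False
        then show ?thesis using step wij j by (simp add: r_def)
      qed
    qed
    have "schedule A (p + \<delta>) (\<lambda>v. x v + r v)"
      unfolding schedule_def
    proof (intro conjI allI)
      show "0 \<le> x v + r v" for v
        using x_nonneg r(1) by (rule add_nonneg_nonneg)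
      show "x Source + r Source = 0"
        by (simp add: x0 r_def)
      have "ext (p + \<delta>) i \<le> x j + r j - (x i + r i)" if "(i, j) \<in> A" for i j
        using delay[OF that] lead_arc[OF that] unfolding ext_add x_def by linarith
      then show "\<forall>(i, j)\<in>A. ext (p + \<delta>) i \<le> x j + r j - (x i + r i)"
        by blast
    qed
    then show "\<exists>y. schedule A (p + \<delta>) y \<and> (\<forall>i\<in>H. y (Job i) = x (Job i))"
      by (intro exI[of _ "\<lambda>v. x v + r v"]) (auto simp: r_def)
  qed
  ultimately show "anchored A p (one_disruption d) (lead Sink + d * D) H"
    by (auto simp: anchored_def)
qed

end

theorem theorem4:
  fixes A :: "'j::finite node rel"
    and p :: "real ^ 'j"
    and d M :: real
    and M' :: int
  assumes "project_graph A"
    and "\<forall>i. 0 \<le> p $ i"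
    and "d > 0"
    and "critical A p"
    and "M \<ge> 0"
    and "M = longest A p Source Sink + d * of_int M'"
  shows "snd ` P_Dom A p (one_disruption d) M = anchored_polytope A p (one_disruption d) M"
proof -
  interpret disrupted_critical_project A p d
    by unfold_locales (use assms in auto)
  have M: "M = lead Sink + d * of_int M'"
    using assms(6) by (simp add: lead_def)
  show ?thesis
    unfolding M anchored_polytope_def anchored_iff_delays proj_P_Dom_eq_delays
    by (rule delays_integrality)
qed

end
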